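(* Let $K$ be a field of characteristic zero, $A$ a commutative associative unital $K$-algebra, $(G,\rho)$ a Lie--Rinehart algebra over $A$, and $\mathcal G=\bigwedge_AG$ with its Schouten--Nijenhuis bracket $[\cdot,\cdot]_{SN}$. For homogeneous $P\in\mathcal G^p$ and $Q\in\mathcal G^q$, \[ [P,Q]_{SN}=-(-1)^{(p-1)(q-1)}[Q,P]_{SN}. \]
   Context: A Lie--Rinehart algebra over $A$ is an $A$-module $G$ endowed with a $K$-Lie bracket $[\cdot,\cdot]$ and an $A$-linear map $\rho:G\to\operatorname{Der}_K(A)$ (the anchor) that is a morphism of $K$-Lie algebras, such that $[x,ay]=a[x,y]+\rho(x)(a)y$ for all $a\in A$, $x,y\in G$. $\mathcal G=\bigwedge_AG=\bigoplus_{p\ge0}\mathcal G^p$ is the exterior algebra over $A$, $\mathcal G^p=\bigwedge_A^pG$, with $\mathcal G^0=A$, $\mathcal G^1=G$ and $\mathcal G^p=0$ for $p<0$. The Schouten--Nijenhuis bracket $[\cdot,\cdot]_{SN}$ is the (well-defined) $K$-bilinear map $\mathcal G\times\mathcal G\to\mathcal G$ given on decomposable elements as follows. For $X=x_1\wedge\cdots\wedge x_p$ and $Y=y_1\wedge\cdots\wedge y_q$ with $x_i,y_j\in G$, let $\widehat X_i$ be $X$ with the factor $x_i$ omitted ($\widehat X_1=1$ if $p=1$), and similarly $\widehat Y_j$. For $p,q\ge1$, \[ [X,Y]_{SN}=\sum_{i=1}^p\sum_{j=1}^q(-1)^{i+j}[x_i,y_j]\wedge\widehat X_i\wedge\widehat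 Y_j . \] For $a\in A$ and $p\ge1$, \[ [X,a]_{SN}=\sum_{i=1}^p(-1)^{p-i}\rho(x_i)(a)\,\widehat X_i,\qquad [a,X]_{SN}=\sum_{i=1}^p(-1)^{i}\rho(x_i)(a)\,\widehat X_i . \] For $a,b\in A$, $[a,b]_{SN}=0$. *)

theory Defs
  imports "HOL-Library.Poly_Mapping" "HOL-Algebra.Algebraic_Closure_Type"
begin

section \<open>Lie--Rinehart algebras\<close>

locale assoc_comm_algebra = vector_space scaleA
  for scaleA :: "'k::field \<Rightarrow> 'a::comm_ring_1 \<Rightarrow> 'a" +
  assumes scaleA_mult: "scaleA c (a * b) = scaleA c a * b"

definition derivation :: "('k::field \<Rightarrow> 'a::comm_ring_1 \<Rightarrow> 'a) \<Rightarrow> ('a \<Rightarrow> 'a) \<Rightarrow> bool" where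
  "derivation scaleA D \<longleftrightarrow>
     Vector_Spaces.linear scaleA scaleA D \<and> (\<forall>a b. D (a * b) = D a * b + a * D b)"

locale lie_algebra = vector_space scaleL
  for scaleL :: "'k::field \<Rightarrow> 'g::ab_group_add \<Rightarrow> 'g" +
  fixes brk :: "'g \<Rightarrow> 'g \<Rightarrow> 'g"
  assumes brk_linear_left: "Vector_Spaces.linear scaleL scaleL (\<lambda>x. brk x y)"
    and brk_linear_right: "Vector_Spaces.linear scaleL scaleL (\<lambda>y. brk x y)"
    and brk_self: "brk x x = 0"
    and jacobi: "brk x (brk y z) + brk y (brk z x) + brk z (brk x y) = 0"

text \<open>\<open>K\<close> acts on \<open>G\<close> through the structure map \<open>c \<mapsto> c \<cdot> 1\<close> from \<open>K\<close> to \<open>A\<close>. The name \<open>module\<close>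
  is qualified because HOL-Algebra has a carrier-based locale of the same name.\<close>

locale lie_rinehart =
  assoc_comm_algebra scaleA +
  G: Modules.module scaleG +
  L: lie_algebra "\<lambda>c. scaleG (scaleA c 1)" brk
  for scaleA :: "'k::field \<Rightarrow> 'a::comm_ring_1 \<Rightarrow> 'a"
    and scaleG :: "'a \<Rightarrow> 'g::ab_group_add \<Rightarrow> 'g"
    and brk :: "'g \<Rightarrow> 'g \<Rightarrow> 'g" +
  fixes rho :: "'g \<Rightarrow> 'a \<Rightarrow> 'a"
  assumes rho_derivation: "derivation scaleA (rho x)"
    and rho_add: "rho (x + y) a = rho x a + rho y a"
    and rho_smult: "rho (scaleG b x) a = b * rho x a"
    and rho_brk: "rho (brk x y) a = rho x (rho y a) - rho y (rho x a)"
    and leibniz: "brk x (scaleG a y) = scaleG a (brk x y) + scaleG (rho x a) y"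

section \<open>The exterior algebra\<close>

text \<open>Words under concatenation form the free monoid, so that the finitely supported functions
  \<open>'g word \<Rightarrow>\<^sub>0 'a\<close> with the convolution product of \<^theory>\<open>HOL-Library.Poly_Mapping\<close> are the free
  associative \<open>A\<close>-algebra on the set \<open>G\<close>.\<close>

datatype 'g word = Word (letters: "'g list")

instantiation word :: (type) monoid_add
begin

definition zero_word :: "'a word" where "0 = Word []"

definition plus_word :: "'a word \<Rightarrow> 'a word \<Rightarrow> 'a word" where
  "v + w = Word (letters v @ letters w)"

instance
  by standard (simp_all add: zero_word_def plus_word_def)

end

type_synonym ('g, 'a) free_alg = "'g word \<Rightarrow>\<^sub>0 'a"

definition scalar :: "'a::comm_ring_1 \<Rightarrow> ('g, 'a) free_alg" where
  "scalar a = Poly_Mapping.single 0 a"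

definition gen :: "'g \<Rightarrow> ('g, 'a::comm_ring_1) free_alg" where
  "gen x = Poly_Mapping.single (Word [x]) 1"

definition gens :: "'g list \<Rightarrow> ('g, 'a::comm_ring_1) free_alg" where
  "gens xs = prod_list (map gen xs)"

text \<open>Dividing out the first two families of relations gives the tensor algebra of the
  \<open>A\<close>-module \<open>G\<close>; the third one makes it the exterior algebra. The type class ring of the free
  algebra is turned into a record, so that two-sided ideals and quotient rings are those of
  HOL-Algebra.\<close>

definition ext_relations :: "('a::comm_ring_1 \<Rightarrow> 'g::ab_group_add \<Rightarrow> 'g) \<Rightarrow> ('g, 'a) free_alg set" where
  "ext_relations scaleG =
     {gen (x + y) - gen x - gen y | x y. True} \<union>
     {gen (scaleG a x) - scalar a * gen x | a x. True} \<union>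
     {gen x * gen x | x. True}"

definition ext_ideal :: "('a::comm_ring_1 \<Rightarrow> 'g::ab_group_add \<Rightarrow> 'g) \<Rightarrow> ('g, 'a) free_alg set" where
  "ext_ideal scaleG = genideal ring_of_type_algebra (ext_relations scaleG)"

definition exterior_algebra ::
    "('a::comm_ring_1 \<Rightarrow> 'g::ab_group_add \<Rightarrow> 'g) \<Rightarrow> ('g, 'a) free_alg set ring" where
  "exterior_algebra scaleG = FactRing ring_of_type_algebra (ext_ideal scaleG)"

text \<open>The canonical projection. It is a ring homomorphism, so the product of the free algebra
  becomes \<open>\<and>\<close>: the class of \<open>gens [x\<^sub>1, \<dots>, x\<^sub>p]\<close> is \<open>x\<^sub>1 \<and> \<cdots> \<and> x\<^sub>p\<close>, and the class of \<open>scalar a\<close>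
  is \<open>a\<close> in degree 0.\<close>

definition ext_class ::
    "('a::comm_ring_1 \<Rightarrow> 'g::ab_group_add \<Rightarrow> 'g) \<Rightarrow> ('g, 'a) free_alg \<Rightarrow> ('g, 'a) free_alg set" where
  "ext_class scaleG u = ext_ideal scaleG +>\<^bsub>ring_of_type_algebra\<^esub> u"

text \<open>The homogeneous component of degree \<open>p\<close>; it is the zero submodule for negative \<open>p\<close>, because
  then only \<open>u = 0\<close> qualifies.\<close>

definition ext_power ::
    "('a::comm_ring_1 \<Rightarrow> 'g::ab_group_add \<Rightarrow> 'g) \<Rightarrow> int \<Rightarrow> ('g, 'a) free_alg set set" where
  "ext_power scaleG p =
     ext_class scaleG ` {u. \<forall>w \<in> Poly_Mapping.keys u. int (length (letters w)) = p}"

definition ext_scale ::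
    "('k::field \<Rightarrow> 'a::comm_ring_1 \<Rightarrow> 'a) \<Rightarrow> ('a \<Rightarrow> 'g::ab_group_add \<Rightarrow> 'g) \<Rightarrow>
     'k \<Rightarrow> ('g, 'a) free_alg set \<Rightarrow> ('g, 'a) free_alg set" where
  "ext_scale scaleA scaleG c P =
     ext_class scaleG (scalar (scaleA c 1)) \<otimes>\<^bsub>exterior_algebra scaleG\<^esub> P"

section \<open>The Schouten--Nijenhuis bracket\<close>

definition omit :: "nat \<Rightarrow> 'g list \<Rightarrow> 'g list" where
  "omit i xs = take i xs @ drop (Suc i) xs"

text \<open>List positions count from 0, so the \<open>i\<close>-th factor in the usual counting from 1 has list
  position \<open>i - 1\<close>; this is why \<open>Suc i\<close> and \<open>Suc j\<close> appear in the signs.\<close>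

definition is_schouten_bracket ::
    "('k::field \<Rightarrow> 'a::comm_ring_1 \<Rightarrow> 'a) \<Rightarrow> ('a \<Rightarrow> 'g::ab_group_add \<Rightarrow> 'g) \<Rightarrow>
     ('g \<Rightarrow> 'g \<Rightarrow> 'g) \<Rightarrow> ('g \<Rightarrow> 'a \<Rightarrow> 'a) \<Rightarrow>
     (('g, 'a) free_alg set \<Rightarrow> ('g, 'a) free_alg set \<Rightarrow> ('g, 'a) free_alg set) \<Rightarrow> bool" where
  "is_schouten_bracket scaleA scaleG brk rho B \<longleftrightarrow>
    (let E = exterior_algebra scaleG; cl = ext_class scaleG; sc = ext_scale scaleA scaleG in
      (\<forall>P \<in> carrier E. \<forall>Q \<in> carrier E. B P Q \<in> carrier E) \<and>
      (\<forall>P \<in> carrier E. \<forall>P' \<in> carrier E. \<forall>Q \<in> carrier E.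
         B (P \<oplus>\<^bsub>E\<^esub> P') Q = B P Q \<oplus>\<^bsub>E\<^esub> B P' Q) \<and>
      (\<forall>P \<in> carrier E. \<forall>Q \<in> carrier E. \<forall>Q' \<in> carrier E.
         B P (Q \<oplus>\<^bsub>E\<^esub> Q') = B P Q \<oplus>\<^bsub>E\<^esub> B P Q') \<and>
      (\<forall>c. \<forall>P \<in> carrier E. \<forall>Q \<in> carrier E. B (sc c P) Q = sc c (B P Q)) \<and>
      (\<forall>c. \<forall>P \<in> carrier E. \<forall>Q \<in> carrier E. B P (sc c Q) = sc c (B P Q)) \<and>
      (\<forall>xs ys. xs \<noteq> [] \<longrightarrow> ys \<noteq> [] \<longrightarrow>
         B (cl (gens xs)) (cl (gens ys)) =
         cl (\<Sum>i<length xs. \<Sum>j<length ys.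
               (- 1) ^ (Suc i + Suc j) * gen (brk (xs ! i) (ys ! j)) * gens (omit i xs) * gens (omit j ys))) \<and>
      (\<forall>xs a. xs \<noteq> [] \<longrightarrow>
         B (cl (gens xs)) (cl (scalar a)) =
         cl (\<Sum>i<length xs.
               (- 1) ^ (length xs - Suc i) * scalar (rho (xs ! i) a) * gens (omit i xs))) \<and>
      (\<forall>a xs. xs \<noteq> [] \<longrightarrow>
         B (cl (scalar a)) (cl (gens xs)) =
         cl (\<Sum>i<length xs. (- 1) ^ Suc i * scalar (rho (xs ! i) a) * gens (omit i xs))) \<and>
      (\<forall>a b. B (cl (scalar a)) (cl (scalar b)) = \<zero>\<^bsub>E\<^esub>))"

text \<open>On the exterior algebra of a Lie--Rinehart algebra such a bracket exists and is unique, since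
  scalars and decomposables generate it additively; the choice operator only picks irrelevant values
  outside the carrier.\<close>

definition schouten_bracket ::
    "('k::field \<Rightarrow> 'a::comm_ring_1 \<Rightarrow> 'a) \<Rightarrow> ('a \<Rightarrow> 'g::ab_group_add \<Rightarrow> 'g) \<Rightarrow>
     ('g \<Rightarrow> 'g \<Rightarrow> 'g) \<Rightarrow> ('g \<Rightarrow> 'a \<Rightarrow> 'a) \<Rightarrow>
     ('g, 'a) free_alg set \<Rightarrow> ('g, 'a) free_alg set \<Rightarrow> ('g, 'a) free_alg set" where
  "schouten_bracket scaleA scaleG brk rho = (SOME B. is_schouten_bracket scaleA scaleG brk rho B)"

end

theory Submission
  imports Defs
begin

text \<open>
  The bracket is first defined on the free algebra, on monomials by
  \<open>[a X, b Y] = a b [X, Y] + a [X, b] Y + b X [a, Y]\<close>. Modulo the relations of the exterior algebra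
  \<open>[a X, -]\<close> is, for \<open>X\<close> of degree \<open>p\<close>, a graded derivation of degree \<open>p - 1\<close>, so it preserves the ideal as soon as it sends
  the three families of relations into it. Graded antisymmetry on monomials is a matter of comparing
  signs, again modulo the ideal; since the relations are homogeneous, it transfers the invariance of
  the ideal to the other argument. Hence the bracket descends to the exterior algebra, it is the only
  one with the prescribed values, and it inherits antisymmetry.
\<close>

text \<open>The bracket is not \<open>A\<close>-bilinear, because the anchor differentiates
  coefficients, so it cannot be fixed on words alone and then extended linearly. Its values are
  fixed on pairs of monomials together with their coefficients. They are forced: modulo the
  relations, \<open>a X\<close> with nonempty \<open>X\<close> is the word whose first letter has
  absorbed \<open>a\<close>, and the Leibniz rule and the anchor then produce the two extra terms.
  On the free algebra such values define a biadditive map without any well-definedness question, but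
  the derivation rule and antisymmetry hold only up to the ideal; hence most computations are
  congruences. The map \<open>[a X, -]\<close> has degree p - 1, yet the exponents contain p + 1:
  the parity is the same, and no subtraction of naturals is truncated at p = 0. Since
  \<open>schouten_bracket\<close> is a choice, nothing is known about it before some map with the
  required values has been constructed; uniqueness then identifies the chosen map with the
  constructed one.\<close>

lemma ring_of_type_algebra_simps:
  "carrier ring_of_type_algebra = UNIV"
  "x \<otimes>\<^bsub>ring_of_type_algebra\<^esub> y = x * y"
  "\<one>\<^bsub>ring_of_type_algebra\<^esub> = 1"
  "\<zero>\<^bsub>ring_of_type_algebra\<^esub> = 0"
  "x \<oplus>\<^bsub>ring_of_type_algebra\<^esub> y = x + y"
  by (simp_all add: ring_of_type_algebra_def)

lemma ring_of_type_algebra_ring: "ring (ring_of_type_algebra :: 'a::ring_1 ring)"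
proof -
  have "\<exists>y. x + y = 0" for x :: 'a
    using add.right_inverse by blast
  then show ?thesis
    unfolding ring_of_type_algebra_def using add.right_inverse
    by unfold_locales (auto simp: algebra_simps Units_def)
qed

lemma a_inv_ring_of_type_algebra:
  "\<ominus>\<^bsub>ring_of_type_algebra\<^esub> (x :: 'a::ring_1) = - x"
proof -
  interpret R: ring "ring_of_type_algebra :: 'a ring"
    by (rule ring_of_type_algebra_ring)
  show ?thesis
    by (rule R.minus_equality) (simp_all add: ring_of_type_algebra_simps)
qed

lemma ideal_ring_of_type_algebraI:
  fixes J :: "'a::ring_1 set"
  assumes "0 \<in> J" and "\<And>u v. u \<in> J \<Longrightarrow> v \<in> J \<Longrightarrow> u + v \<in> J"
    and "\<And>u. u \<in> J \<Longrightarrow> - u \<in> J"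
    and "\<And>u v. u \<in> J \<Longrightarrow> v * u \<in> J" and "\<And>u v. u \<in> J \<Longrightarrow> u * v \<in> J"
  shows "ideal J ring_of_type_algebra"
proof -
  interpret R: ring "ring_of_type_algebra :: 'a ring"
    by (rule ring_of_type_algebra_ring)
  show ?thesis
  proof (rule idealI)
    show "subgroup J (add_monoid ring_of_type_algebra)"
    proof (rule group.subgroupI[OF R.add.group_axioms])
      show "inv\<^bsub>add_monoid ring_of_type_algebra\<^esub> u \<in> J" if "u \<in> J" for u
        using assms(3)[OF that] a_inv_ring_of_type_algebra[of u] by (simp add: a_inv_def)
    qed (use assms(1,2) in \<open>auto simp: ring_of_type_algebra_simps\<close>)
  qed (use assms R.ring_axioms in \<open>auto simp: ring_of_type_algebra_simps\<close>)
qed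

section \<open>Sums over the monomials of the free algebra\<close>

text \<open>The coefficient is an argument of \<open>f\<close> and not a factor, because the bracket
  is additive but not \<open>A\<close>-linear in it.\<close>

definition lin :: "('w \<Rightarrow> 'a \<Rightarrow> 'b) \<Rightarrow> ('w \<Rightarrow>\<^sub>0 'a::zero) \<Rightarrow> 'b::comm_monoid_add" where
  "lin f u = (\<Sum>w\<in>Poly_Mapping.keys u. f w (Poly_Mapping.lookup u w))"

lemma lin_superset:
  assumes "finite S" "Poly_Mapping.keys u \<subseteq> S" "\<And>w. f w 0 = 0"
  shows "lin f u = (\<Sum>w\<in>S. f w (Poly_Mapping.lookup u w))"
  unfolding lin_def
  by (rule sum.mono_neutral_left) (use assms in \<open>auto simp: in_keys_iff\<close>)

lemma lin_zero [simp]: "lin f 0 = 0"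
  by (simp add: lin_def)

lemma lin_single: "f w 0 = 0 \<Longrightarrow> lin f (Poly_Mapping.single w a) = f w a"
  by (simp add: lin_def)

lemma lin_add:
  fixes u v :: "'w \<Rightarrow>\<^sub>0 'a::monoid_add"
  assumes "\<And>w. f w 0 = 0" "\<And>w a b. f w (a + b) = f w a + f w b"
  shows "lin f (u + v) = lin f u + lin f v"
proof -
  let ?S = "Poly_Mapping.keys u \<union> Poly_Mapping.keys v"
  have "lin f (u + v) = (\<Sum>w\<in>?S. f w (Poly_Mapping.lookup (u + v) w))"
    by (rule lin_superset) (use keys_add[of u v] assms in auto)
  also have "\<dots> = lin f u + lin f v"
    by (simp add: lin_superset[of ?S] assms lookup_add sum.distrib)
  finally show ?thesis .
qed

lemma lin_distrib: "lin (\<lambda>w a. f w a + g w a) u = lin f u + lin g u"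
  by (simp add: lin_def sum.distrib)

lemma poly_mapping_eq_sum_single:
  "u = (\<Sum>w\<in>Poly_Mapping.keys u. Poly_Mapping.single w (Poly_Mapping.lookup u w))"
  by (rule poly_mapping_eqI) (simp add: lookup_sum lookup_single when_def in_keys_iff)

text \<open>The inductive step meets only words in the support of \<open>u\<close>, so homogeneity
  of \<open>u\<close> fixes the length of each of them; the remainder \<open>v\<close> carries no
  such information.\<close>

lemma poly_mapping_induct_single [case_names zero add]:
  fixes u :: "'w \<Rightarrow>\<^sub>0 'a::comm_monoid_add"
  assumes "P 0" and "\<And>w a v. w \<in> Poly_Mapping.keys u \<Longrightarrow> P v \<Longrightarrow> P (Poly_Mapping.single w a + v)"
  shows "P u"
proof -
  have "P (\<Sum>w\<in>S. Poly_Mapping.single w (Poly_Mapping.lookup u w))"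
    if "finite S" "S \<subseteq> Poly_Mapping.keys u" for S
    using that by (induction S rule: finite_induct) (auto simp: assms)
  then show ?thesis
    using poly_mapping_eq_sum_single[of u] finite_keys[of u] by (metis order_refl)
qed

section \<open>Words, central scalars and signs in the free algebra\<close>

lemma gens_simps [simp]:
  "gens [] = 1" "gens (x # xs) = gen x * gens xs" "gens (xs @ ys) = gens xs * gens ys"
  by (simp_all add: gens_def)

lemma gens_eq_single: "gens xs = Poly_Mapping.single (Word xs) 1"
  by (induction xs) (simp_all add: gen_def mult_single plus_word_def flip: zero_word_def)

lemma single_eq_scalar_gens: "Poly_Mapping.single (Word xs) a = scalar a * gens xs"
  by (simp add: gens_eq_single scalar_def mult_single)

lemma scalar_simps [simp]:
  "scalar 0 = 0" "scalar 1 = 1"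
  by (simp_all add: scalar_def)

lemma scalar_add: "scalar (a + b) = scalar a + scalar b"
  and scalar_minus: "scalar (- a) = - scalar a"
  and scalar_mult: "scalar (a * b) = scalar a * scalar b"
  by (simp_all add: scalar_def single_add single_uminus mult_single)

lemma scalar_commute: "u * scalar a = scalar a * (u :: ('g, 'a::comm_ring_1) free_alg)"
proof (induction u rule: poly_mapping_induct_single)
  case (add w b v)
  have "Poly_Mapping.single w b * scalar a = scalar a * Poly_Mapping.single w b"
    by (simp add: scalar_def mult_single mult.commute)
  then show ?case
    using add by (simp add: algebra_simps)
qed simp

lemma scalar_left_commute:
  "u * (scalar a * v) = scalar a * (u * (v :: ('g, 'a::comm_ring_1) free_alg))"
  by (metis mult.assoc scalar_commute)

lemma neg_one_power_commute: "u * (- 1) ^ n = (- 1) ^ n * (u :: 'b::ring_1)"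
  by (cases "even n") simp_all

lemma neg_one_power_left_commute: "u * ((- 1) ^ n * v) = (- 1) ^ n * (u * (v :: 'b::ring_1))"
  by (cases "even n") simp_all

text \<open>Together with \<open>scalar_moves\<close> these lead to a normal form: signs first, then
  scalars, then generators and words.\<close>

lemmas neg_one_power_moves =
  neg_one_power_commute[of "(- 1) ^ m" for m] neg_one_power_left_commute[of "(- 1) ^ m" for m]
  neg_one_power_commute[of "gen x" for x] neg_one_power_left_commute[of "gen x" for x]
  neg_one_power_commute[of "gens xs" for xs] neg_one_power_left_commute[of "gens xs" for xs]
  neg_one_power_commute[of "scalar a" for a] neg_one_power_left_commute[of "scalar a" for a]

lemmas scalar_moves =
  scalar_commute[of "gen x" for x] scalar_left_commute[of "gen x" for x]
  scalar_commute[of "gens xs" for xs] scalar_left_commute[of "gens xs" for xs]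
  scalar_commute[of "scalar a" for a] scalar_left_commute[of "scalar a" for a]

section \<open>Homogeneous elements of the free algebra\<close>

definition homog :: "nat \<Rightarrow> ('g, 'a::zero) free_alg \<Rightarrow> bool" where
  "homog d u \<longleftrightarrow> (\<forall>w\<in>Poly_Mapping.keys u. length (letters w) = d)"

lemma homog_zero [simp]: "homog d 0"
  by (simp add: homog_def)

lemma homog_single: "length (letters w) = d \<Longrightarrow> homog d (Poly_Mapping.single w a)"
  by (simp add: homog_def)

lemma homog_scalar: "homog 0 (scalar a)"
  by (simp add: homog_def scalar_def zero_word_def)

lemma homog_gens: "homog (length xs) (gens xs)"
  by (simp add: homog_def gens_eq_single)

lemma homog_gen: "homog (Suc 0) (gen x)"
  by (simp add: homog_def gen_def)

lemma homog_add: "homog d u \<Longrightarrow> homog d v \<Longrightarrow> homog d (u + v)"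
  using keys_add[of u v] by (auto simp: homog_def)

lemma homog_uminus: "homog d u \<Longrightarrow> homog d (- u)" for u :: "('g, 'a::ab_group_add) free_alg"
  by (simp add: homog_def in_keys_iff)

lemma homog_diff: "homog d u \<Longrightarrow> homog d v \<Longrightarrow> homog d (u - v)"
  for u v :: "('g, 'a::ab_group_add) free_alg"
  using homog_add[OF _ homog_uminus, of d u v] by simp

lemma homog_mult: "homog d u \<Longrightarrow> homog e v \<Longrightarrow> homog (d + e) (u * v)"
  using keys_mult[of u v] by (fastforce simp: homog_def plus_word_def)

lemma homog_scalar_mult: "homog d u \<Longrightarrow> homog d (scalar a * u)"
  using homog_mult[OF homog_scalar] by fastforce

lemma homog_neg_one_power_mult: "homog d u \<Longrightarrow> homog d ((- 1) ^ n * u)"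
  for u :: "('g, 'a::comm_ring_1) free_alg"
  by (cases "even n") (simp_all add: homog_uminus)

lemma homog_sum: "(\<And>i. i \<in> S \<Longrightarrow> homog d (f i)) \<Longrightarrow> homog d (sum f S)"
  by (induction S rule: infinite_finite_induct) (auto intro: homog_add)

section \<open>Congruence modulo the relations of the exterior algebra\<close>

locale exterior =
  fixes scaleG :: "'a::comm_ring_1 \<Rightarrow> 'g::ab_group_add \<Rightarrow> 'g"
begin

lemma ideal_ext_ideal: "ideal (ext_ideal scaleG) ring_of_type_algebra"
  unfolding ext_ideal_def
  by (rule ring.genideal_ideal[OF ring_of_type_algebra_ring]) (simp add: ring_of_type_algebra_simps)

lemma ext_relations_subset: "ext_relations scaleG \<subseteq> ext_ideal scaleG"
  unfolding ext_ideal_def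
  by (rule ring.genideal_self[OF ring_of_type_algebra_ring]) (simp add: ring_of_type_algebra_simps)

lemma ext_ideal_zero: "0 \<in> ext_ideal scaleG"
  and ext_ideal_add: "u \<in> ext_ideal scaleG \<Longrightarrow> v \<in> ext_ideal scaleG \<Longrightarrow> u + v \<in> ext_ideal scaleG"
  and ext_ideal_uminus: "u \<in> ext_ideal scaleG \<Longrightarrow> - u \<in> ext_ideal scaleG"
  and ext_ideal_mult_left: "u \<in> ext_ideal scaleG \<Longrightarrow> w * u \<in> ext_ideal scaleG"
  and ext_ideal_mult_right: "u \<in> ext_ideal scaleG \<Longrightarrow> u * w \<in> ext_ideal scaleG"
proof -
  interpret ideal "ext_ideal scaleG" ring_of_type_algebra
    by (rule ideal_ext_ideal)
  show "0 \<in> ext_ideal scaleG"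
    using additive_subgroup.zero_closed[OF is_additive_subgroup]
    by (simp add: ring_of_type_algebra_simps)
  show "u + v \<in> ext_ideal scaleG" if "u \<in> ext_ideal scaleG" "v \<in> ext_ideal scaleG"
    using additive_subgroup.a_closed[OF is_additive_subgroup that]
    by (simp add: ring_of_type_algebra_simps)
  show "- u \<in> ext_ideal scaleG" if "u \<in> ext_ideal scaleG"
    using I_l_closed[OF that, of "- 1"] by (simp add: ring_of_type_algebra_simps)
  show "w * u \<in> ext_ideal scaleG" "u * w \<in> ext_ideal scaleG" if "u \<in> ext_ideal scaleG"
    using I_l_closed[OF that] I_r_closed[OF that] by (simp_all add: ring_of_type_algebra_simps)
qed

lemma ext_ideal_induct [consumes 1, case_names relation zero add uminus]:
  assumes "u \<in> ext_ideal scaleG"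
    and relation: "\<And>l r n. r \<in> ext_relations scaleG \<Longrightarrow> P (l * r * n)"
    and zero: "P 0" and add: "\<And>u v. P u \<Longrightarrow> P v \<Longrightarrow> P (u + v)" and uminus: "\<And>u. P u \<Longrightarrow> P (- u)"
  shows "P u"
proof -
  \<comment> \<open>\<open>P\<close> need not be stable under multiplication. Requiring it of all
    two-sided multiples makes \<open>J\<close> an ideal, so minimality of the generated ideal
    applies; \<open>l = n = 1\<close> recovers \<open>P\<close>.\<close>
  define J where "J = {u. \<forall>l n. P (l * u * n)}"
  have "ideal J ring_of_type_algebra"
  proof (rule ideal_ring_of_type_algebraI)
    show "v * u \<in> J" if "u \<in> J" for u v
      using that by (simp add: J_def flip: mult.assoc)
    show "u * v \<in> J" if "u \<in> J" for u v
      using that by (simp add: J_def mult.assoc)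
  qed (auto simp: J_def zero distrib_left distrib_right add uminus)
  moreover have "ext_relations scaleG \<subseteq> J"
    by (auto simp: J_def relation)
  ultimately have "ext_ideal scaleG \<subseteq> J"
    unfolding ext_ideal_def by (rule ring.genideal_minimal[OF ring_of_type_algebra_ring])
  with assms(1) have "P (1 * u * 1)"
    unfolding J_def by blast
  then show ?thesis by simp
qed

text \<open>Working with representatives keeps the type-class arithmetic of the free algebra; cosets
  return only in \<open>ext_class_eq_iff\<close>.\<close>

definition ext_cong :: "('g, 'a) free_alg \<Rightarrow> ('g, 'a) free_alg \<Rightarrow> bool" (infix "\<approx>" 50) where
  "u \<approx> v \<longleftrightarrow> u - v \<in> ext_ideal scaleG"

lemma ext_cong_refl [simp, intro]: "u \<approx> u"
  by (simp add: ext_cong_def ext_ideal_zero)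

lemma ext_cong_sym: "u \<approx> v \<Longrightarrow> v \<approx> u"
  using ext_ideal_uminus[of "u - v"] by (simp add: ext_cong_def)

lemma ext_cong_trans [trans]: "u \<approx> v \<Longrightarrow> v \<approx> w \<Longrightarrow> u \<approx> w"
  using ext_ideal_add[of "u - v" "v - w"] by (simp add: ext_cong_def)

lemma ext_cong_add: "u \<approx> u' \<Longrightarrow> v \<approx> v' \<Longrightarrow> u + v \<approx> u' + v'"
  using ext_ideal_add[of "u - u'" "v - v'"] by (simp add: ext_cong_def algebra_simps)

lemma ext_cong_uminus: "u \<approx> u' \<Longrightarrow> - u \<approx> - u'"
  using ext_ideal_uminus[of "u - u'"] by (simp add: ext_cong_def algebra_simps)

lemma ext_cong_diff: "u \<approx> u' \<Longrightarrow> v \<approx> v' \<Longrightarrow> u - v \<approx> u' - v'"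
  using ext_cong_add[OF _ ext_cong_uminus, of u u' v v'] by simp

lemma ext_cong_mult: "u \<approx> u' \<Longrightarrow> v \<approx> v' \<Longrightarrow> u * v \<approx> u' * v'"
  using ext_ideal_add[OF ext_ideal_mult_right ext_ideal_mult_left, of "u - u'" "v - v'" v u']
  by (simp add: ext_cong_def algebra_simps)

lemma ext_cong_mult_left: "v \<approx> v' \<Longrightarrow> u * v \<approx> u * v'"
  by (simp add: ext_cong_mult)

lemma ext_cong_mult_right: "u \<approx> u' \<Longrightarrow> u * v \<approx> u' * v"
  by (simp add: ext_cong_mult)

lemma ext_cong_sum: "(\<And>i. i \<in> S \<Longrightarrow> f i \<approx> g i) \<Longrightarrow> sum f S \<approx> sum g S"
  by (induction S rule: infinite_finite_induct) (auto intro: ext_cong_add)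

lemma ext_cong_gen_add: "gen (x + y) \<approx> gen x + gen y"
  using ext_relations_subset by (force simp: ext_cong_def ext_relations_def algebra_simps)

lemma ext_cong_gen_scale: "gen (scaleG a x) \<approx> scalar a * gen x"
  using ext_relations_subset by (force simp: ext_cong_def ext_relations_def)

lemma ext_cong_gen_square: "gen x * gen x \<approx> 0"
  using ext_relations_subset by (force simp: ext_cong_def ext_relations_def)

text \<open>Polarisation: the square of \<open>gen (x + y)\<close> is expanded and the two pure
  squares are removed.\<close>

lemma ext_cong_gen_anticommute: "gen x * gen y \<approx> - (gen y * gen x)"
proof -
  let ?S = "gen (x + y) * gen (x + y) :: ('g, 'a) free_alg"
  have "?S \<approx> (gen x + gen y) * (gen x + gen y)"
    by (intro ext_cong_mult ext_cong_gen_add)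
  also have "\<dots> = (gen x * gen x + gen y * gen y) + (gen x * gen y + gen y * gen x)"
    by (simp add: algebra_simps)
  finally have "(gen x * gen x + gen y * gen y) + (gen x * gen y + gen y * gen x) \<approx> 0"
    using ext_cong_gen_square ext_cong_sym ext_cong_trans by blast
  from ext_cong_diff[OF this ext_cong_add[OF ext_cong_gen_square[of x] ext_cong_gen_square[of y]]]
  show ?thesis
    by (simp add: ext_cong_def)
qed

lemma ext_cong_gen_gens_commute: "gen x * gens ys \<approx> (- 1) ^ length ys * (gens ys * gen x)"
proof (induction ys)
  case (Cons y ys)
  have "gen x * gens (y # ys) = (gen x * gen y) * gens ys"
    by (simp add: mult.assoc)
  also have "\<dots> \<approx> - (gen y * gen x) * gens ys"
    by (intro ext_cong_mult_right ext_cong_gen_anticommute)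
  also have "- (gen y * gen x) * gens ys = - gen y * (gen x * gens ys)"
    by (simp add: mult.assoc)
  also have "\<dots> \<approx> - gen y * ((- 1) ^ length ys * (gens ys * gen x))"
    by (intro ext_cong_mult_left Cons)
  also have "\<dots> = (- 1) ^ length (y # ys) * (gens (y # ys) * gen x)"
    by (simp add: mult.assoc neg_one_power_moves)
  finally show ?case .
qed simp

lemma ext_cong_gens_commute:
  "gens xs * gens ys \<approx> (- 1) ^ (length xs * length ys) * (gens ys * gens xs)"
proof (induction xs)
  case (Cons x xs)
  have "gens (x # xs) * gens ys = gen x * (gens xs * gens ys)"
    by (simp add: mult.assoc)
  also have "\<dots> \<approx> gen x * ((- 1) ^ (length xs * length ys) * (gens ys * gens xs))"
    by (intro ext_cong_mult_left Cons)
  also have "\<dots> = (- 1) ^ (length xs * length ys) * (gen x * gens ys * gens xs)"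
    by (simp add: mult.assoc neg_one_power_moves)
  also have "\<dots> \<approx> (- 1) ^ (length xs * length ys) * ((- 1) ^ length ys * (gens ys * gen x) * gens xs)"
    by (intro ext_cong_mult_left ext_cong_mult_right ext_cong_gen_gens_commute)
  also have "\<dots> = (- 1) ^ (length (x # xs) * length ys) * (gens ys * gens (x # xs))"
    by (simp add: mult.assoc power_add neg_one_power_moves)
  finally show ?case .
qed simp

text \<open>Reduction to words, whose letters anticommute; homogeneity makes the sign the same for
  all pairs of monomials.\<close>

lemma ext_cong_homog_commute:
  assumes "homog d u" "homog e v"
  shows "u * v \<approx> (- 1) ^ (d * e) * (v * u)"
proof -
  have single: "Poly_Mapping.single w a * Poly_Mapping.single z b \<approx>
      (- 1) ^ (d * e) * (Poly_Mapping.single z b * Poly_Mapping.single w a)"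
    if "length (letters w) = d" "length (letters z) = e" for w z a b
  proof (cases w; cases z)
    fix xs ys assume wz: "w = Word xs" "z = Word ys"
    have "Poly_Mapping.single w a * Poly_Mapping.single z b =
        scalar a * scalar b * (gens xs * gens ys)"
      by (simp add: wz single_eq_scalar_gens mult.assoc scalar_moves)
    also have "\<dots> \<approx> scalar a * scalar b * ((- 1) ^ (d * e) * (gens ys * gens xs))"
      using that wz ext_cong_gens_commute[of xs ys] by (auto intro: ext_cong_mult_left)
    also have "\<dots> = (- 1) ^ (d * e) * (Poly_Mapping.single z b * Poly_Mapping.single w a)"
      by (simp add: wz single_eq_scalar_gens mult.assoc scalar_moves
          neg_one_power_moves)
    finally show ?thesis .
  qed
  have "Poly_Mapping.single w a * v \<approx> (- 1) ^ (d * e) * (v * Poly_Mapping.single w a)"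
    if "length (letters w) = d" for w a
  proof (induction v rule: poly_mapping_induct_single)
    case (add z b v)
    then have "length (letters z) = e"
      using assms(2) by (simp add: homog_def)
    from ext_cong_add[OF single[OF that this] add(2)] show ?case
      by (simp add: distrib_left distrib_right)
  qed simp
  then show ?thesis
  proof (induction u rule: poly_mapping_induct_single)
    case (add w a u)
    then have "length (letters w) = d"
      using assms(1) by (simp add: homog_def)
    from ext_cong_add[OF add(3)[OF this] add(2)[OF add(3)]] show ?case
      by (simp add: distrib_left distrib_right)
  qed simp
qed

section \<open>From congruences to the quotient ring\<close>

lemma ext_class_eq_iff: "ext_class scaleG u = ext_class scaleG v \<longleftrightarrow> u \<approx> v"
proof -
  have "ext_class scaleG u = ext_class scaleG v \<longleftrightarrow>
      u \<ominus>\<^bsub>ring_of_type_algebra\<^esub> v \<in> ext_ideal scaleG"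
    unfolding ext_class_def
    by (rule ring.quotient_eq_iff_same_a_r_cos[OF ring_of_type_algebra_ring ideal_ext_ideal, symmetric])
      (simp_all add: ring_of_type_algebra_simps)
  then show ?thesis
    by (simp add: ext_cong_def a_minus_def a_inv_ring_of_type_algebra ring_of_type_algebra_simps)
qed

lemma carrier_exterior_algebra: "carrier (exterior_algebra scaleG) = range (ext_class scaleG)"
  by (auto simp: exterior_algebra_def FactRing_def A_RCOSETS_def' a_r_coset_def' ext_class_def
      ring_of_type_algebra_simps)

lemma exterior_algebra_mult:
  "ext_class scaleG u \<otimes>\<^bsub>exterior_algebra scaleG\<^esub> ext_class scaleG v = ext_class scaleG (u * v)"
  and exterior_algebra_add:
  "ext_class scaleG u \<oplus>\<^bsub>exterior_algebra scaleG\<^esub> ext_class scaleG v = ext_class scaleG (u + v)"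
  and exterior_algebra_zero: "\<zero>\<^bsub>exterior_algebra scaleG\<^esub> = ext_class scaleG 0"
proof -
  interpret ideal "ext_ideal scaleG" ring_of_type_algebra
    by (rule ideal_ext_ideal)
  interpret h: ring_hom_ring ring_of_type_algebra "exterior_algebra scaleG" "ext_class scaleG"
    using rcos_ring_hom_ring by (simp add: exterior_algebra_def ext_class_def[abs_def])
  show "ext_class scaleG u \<otimes>\<^bsub>exterior_algebra scaleG\<^esub> ext_class scaleG v = ext_class scaleG (u * v)"
    using h.hom_mult[of u v] by (simp add: ring_of_type_algebra_simps)
  show "ext_class scaleG u \<oplus>\<^bsub>exterior_algebra scaleG\<^esub> ext_class scaleG v = ext_class scaleG (u + v)"
    using h.hom_add[of u v] by (simp add: ring_of_type_algebra_simps)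
  show "\<zero>\<^bsub>exterior_algebra scaleG\<^esub> = ext_class scaleG 0"
    using h.hom_zero by (simp add: ring_of_type_algebra_simps)
qed

lemma ext_scale_class:
  "ext_scale scaleA scaleG c (ext_class scaleG u) = ext_class scaleG (scalar (scaleA c 1) * u)"
  by (simp add: ext_scale_def exterior_algebra_mult)

end

section \<open>Alternating contractions\<close>

text \<open>If \<open>f\<close> has values of degree d, this is the value on the word
  \<open>xs\<close> of the graded derivation of degree d - 1 with \<open>f x\<close> at the
  generator \<open>x\<close>. The derivation sign at position i is that of (d - 1) i, and moving the
  new factor to the front costs that of d i; together they leave the sign of i, whatever d is. Three
  degrees occur later: 0 for \<open>rho\<close>, 1 for \<open>brk\<close>, and the length of
  \<open>xs\<close> for \<open>brk_gen a xs\<close>.\<close>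

definition alt :: "('g \<Rightarrow> ('g, 'a::comm_ring_1) free_alg) \<Rightarrow> 'g list \<Rightarrow> ('g, 'a) free_alg" where
  "alt f xs = (\<Sum>i<length xs. (- 1) ^ i * f (xs ! i) * gens (omit i xs))"

lemma length_omit: "i < length xs \<Longrightarrow> length (omit i xs) = length xs - 1"
  by (simp add: omit_def)

lemma omit_Cons [simp]: "omit 0 (x # xs) = xs" "omit (Suc i) (x # xs) = x # omit i xs"
  by (simp_all add: omit_def)

lemma alt_Nil [simp]: "alt f [] = 0"
  by (simp add: alt_def)

lemma alt_add: "alt (\<lambda>x. f x + g x) xs = alt f xs + alt g xs"
  by (simp add: alt_def distrib_left distrib_right sum.distrib)

lemma alt_diff: "alt (\<lambda>x. f x - g x) xs = alt f xs - alt g xs"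
  by (simp add: alt_def left_diff_distrib right_diff_distrib sum_subtractf)

lemma alt_scalar_mult: "alt (\<lambda>x. scalar a * f x) xs = scalar a * alt f xs"
  by (simp add: alt_def sum_distrib_left mult.assoc neg_one_power_moves)

lemma alt_scalar_mult_scalar:
  "alt (\<lambda>x. scalar (a * g x)) xs = scalar a * alt (\<lambda>x. scalar (g x)) xs"
  by (simp add: scalar_mult alt_scalar_mult)

lemma alt_mult_right:
  "alt (\<lambda>y. scalar (g y) * u) ys = u * alt (\<lambda>y. scalar (g y)) ys"
  by (simp add: alt_def sum_distrib_left mult.assoc neg_one_power_left_commute[of u]
      scalar_left_commute[of u])

lemma alt_zero [simp]: "alt (\<lambda>x. 0) xs = 0"
  by (simp add: alt_def)

text \<open>The subtraction is truncated only for d = 0 and empty \<open>xs\<close>; there the sum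
  is empty, and 0 is homogeneous of every degree.\<close>

lemma homog_alt:
  assumes "\<And>x. homog d (f x)"
  shows "homog (d + length xs - 1) (alt f xs)"
  unfolding alt_def
proof (rule homog_sum)
  fix i assume i: "i \<in> {..<length xs}"
  from homog_mult[OF assms[of "xs ! i"] homog_gens[of "omit i xs"]] i
  have "homog (d + length xs - 1) (f (xs ! i) * gens (omit i xs))"
    by (simp add: length_omit Suc_leI)
  then show "homog (d + length xs - 1) ((- 1) ^ i * f (xs ! i) * gens (omit i xs))"
    by (simp add: mult.assoc homog_neg_one_power_mult)
qed

context exterior
begin

lemma alt_cong: "(\<And>x. f x \<approx> g x) \<Longrightarrow> alt f xs \<approx> alt g xs"
  unfolding alt_def by (intro ext_cong_sum ext_cong_mult_right ext_cong_mult_left)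

text \<open>The index shift contributes one sign, and moving \<open>gen y\<close> in front of the
  values of \<open>f\<close> contributes d more.\<close>

lemma alt_Cons:
  assumes "\<And>x. homog d (f x)"
  shows "alt f (y # ys) \<approx> f y * gens ys + (- 1) ^ Suc d * (gen y * alt f ys)"
proof -
  have commute: "f x * gen y \<approx> (- 1) ^ d * (gen y * f x)" for x
    using ext_cong_homog_commute[OF assms[of x] homog_gen[of y]] by simp
  have "alt f (y # ys) = f y * gens ys + (\<Sum>i<length ys. (- 1) ^ Suc i * (f (ys ! i) * gen y) * gens (omit i ys))"
    by (simp add: alt_def sum.lessThan_Suc_shift mult.assoc del: sum.lessThan_Suc)
  also have "\<dots> \<approx> f y * gens ys +
      (\<Sum>i<length ys. (- 1) ^ Suc i * ((- 1) ^ d * (gen y * f (ys ! i))) * gens (omit i ys))"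
    by (intro ext_cong_add ext_cong_sum ext_cong_mult_right ext_cong_mult_left ext_cong_refl commute)
  also have "\<dots> = f y * gens ys + (- 1) ^ Suc d * (gen y * alt f ys)"
    by (simp add: alt_def sum_distrib_left mult.assoc neg_one_power_moves sum_negf)
  finally show ?thesis .
qed

text \<open>The graded Leibniz rule of a derivation of degree d - 1, with d + 1 in the exponent so
  that d = 0 is covered.\<close>

lemma alt_append:
  assumes "\<And>x. homog d (f x)"
  shows "alt f (ys @ zs) \<approx> alt f ys * gens zs + (- 1) ^ (Suc d * length ys) * (gens ys * alt f zs)"
proof (induction ys)
  case (Cons y ys)
  have "alt f ((y # ys) @ zs) \<approx> f y * gens (ys @ zs) + (- 1) ^ Suc d * (gen y * alt f (ys @ zs))"
    using alt_Cons[of d f y "ys @ zs", OF assms] by simp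
  also have "\<dots> \<approx> f y * gens (ys @ zs) + (- 1) ^ Suc d * (gen y *
      (alt f ys * gens zs + (- 1) ^ (Suc d * length ys) * (gens ys * alt f zs)))"
    by (intro ext_cong_add ext_cong_mult_left Cons ext_cong_refl)
  also have "\<dots> = (f y * gens ys + (- 1) ^ Suc d * (gen y * alt f ys)) * gens zs +
      (- 1) ^ (Suc d * length (y # ys)) * (gens (y # ys) * alt f zs)"
    by (simp add: algebra_simps power_add neg_one_power_moves)
  also have "\<dots> \<approx> alt f (y # ys) * gens zs +
      (- 1) ^ (Suc d * length (y # ys)) * (gens (y # ys) * alt f zs)"
    by (intro ext_cong_add ext_cong_mult_right ext_cong_sym[OF alt_Cons] assms ext_cong_refl)
  finally show ?case .
qed simp

lemma ext_cong_gen_uminus: "gen (- x) \<approx> - gen x"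
proof -
  have "gen (0 + 0) \<approx> gen 0 + gen (0::'g)"
    by (rule ext_cong_gen_add)
  then have zero: "gen 0 \<approx> 0"
    using ext_ideal_uminus[of "- gen 0"] by (simp add: ext_cong_def)
  have "gen (- x + x) \<approx> gen (- x) + gen x"
    by (rule ext_cong_gen_add)
  from ext_cong_trans[OF ext_cong_sym[OF this]] zero have "gen (- x) + gen x \<approx> 0"
    by simp
  then show ?thesis
    by (simp add: ext_cong_def)
qed

end

section \<open>The bracket on the free algebra\<close>

sublocale lie_rinehart \<subseteq> exterior scaleG .

context lie_rinehart
begin

section \<open>Elementary rules for the anchor and the Lie bracket\<close>

lemma rho_add_right: "rho x (a + b) = rho x a + rho x b"
  and rho_scale_right: "rho x (scaleA c a) = scaleA c (rho x a)"
  and rho_mult: "rho x (a * b) = rho x a * b + a * rho x b"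
  and rho_zero [simp]: "rho x 0 = 0"
proof -
  interpret D: Vector_Spaces.linear scaleA scaleA "rho x"
    using rho_derivation by (simp add: derivation_def)
  show "rho x (a + b) = rho x a + rho x b" "rho x (scaleA c a) = scaleA c (rho x a)" "rho x 0 = 0"
    by (simp_all add: D.add D.scale D.zero)
  show "rho x (a * b) = rho x a * b + a * rho x b"
    using rho_derivation by (simp add: derivation_def)
qed

lemma rho_one [simp]: "rho x 1 = 0"
  using rho_mult[of x 1 1] by simp

lemma scaleA_eq_mult: "scaleA c a = scaleA c 1 * a"
  using scaleA_mult[of c 1 a] by simp

lemma rho_const_mult: "rho x (scaleA c 1 * a) = scaleA c 1 * rho x a"
  by (metis rho_scale_right scaleA_eq_mult)

lemma brk_add_left: "brk (x + y) z = brk x z + brk y z"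
  and brk_add_right: "brk z (x + y) = brk z x + brk z y"
proof -
  interpret l: Vector_Spaces.linear "\<lambda>c. scaleG (scaleA c 1)" "\<lambda>c. scaleG (scaleA c 1)" "\<lambda>x. brk x z"
    by (rule L.brk_linear_left)
  interpret r: Vector_Spaces.linear "\<lambda>c. scaleG (scaleA c 1)" "\<lambda>c. scaleG (scaleA c 1)" "\<lambda>x. brk z x"
    by (rule L.brk_linear_right)
  show "brk (x + y) z = brk x z + brk y z" "brk z (x + y) = brk z x + brk z y"
    by (simp_all add: l.add r.add)
qed

lemma brk_anticommute: "brk y x = - brk x y"
  using L.brk_self[of "x + y"] L.brk_self[of x] L.brk_self[of y]
  by (simp add: brk_add_left brk_add_right eq_neg_iff_add_eq_0 add.commute)

text \<open>\<open>brk_gen a xs y\<close> lifts \<open>[a X, y]\<close> for \<open>X = gens xs\<close>, and \<open>brk_mono a xs b ys\<close> lifts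
  \<open>[a X, b Y] = [a X, b] Y + b [a X, Y]\<close> for \<open>Y = gens ys\<close>.\<close>

definition brk_gen :: "'a \<Rightarrow> 'g list \<Rightarrow> 'g \<Rightarrow> ('g, 'a) free_alg" where
  "brk_gen a xs y = scalar a * alt (\<lambda>x. gen (brk x y)) xs - scalar (rho y a) * gens xs"

definition brk_mono :: "'a \<Rightarrow> 'g list \<Rightarrow> 'a \<Rightarrow> 'g list \<Rightarrow> ('g, 'a) free_alg" where
  "brk_mono a xs b ys =
     (- 1) ^ Suc (length xs) * (scalar a * (alt (\<lambda>x. scalar (rho x b)) xs * gens ys)) +
     scalar b * alt (brk_gen a xs) ys"

lemma homog_brk_gen: "homog (length xs) (brk_gen a xs y)"
  unfolding brk_gen_def
  using homog_alt[of 1 "\<lambda>x. gen (brk x y)" xs]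
  by (intro homog_diff homog_scalar_mult homog_gens) (simp add: homog_gen)

lemma brk_mono_zero [simp]: "brk_mono 0 xs b ys = 0" "brk_mono a xs 0 ys = 0"
  by (simp_all add: brk_mono_def brk_gen_def[abs_def])

lemma brk_mono_add_right: "brk_mono a xs (b + c) ys = brk_mono a xs b ys + brk_mono a xs c ys"
  by (simp add: brk_mono_def rho_add_right scalar_add alt_add algebra_simps)

lemma brk_gen_add_left: "brk_gen (a + b) xs y = brk_gen a xs y + brk_gen b xs y"
  by (simp add: brk_gen_def rho_add_right scalar_add algebra_simps)

lemma brk_mono_add_left: "brk_mono (a + b) xs c ys = brk_mono a xs c ys + brk_mono b xs c ys"
  by (simp add: brk_mono_def brk_gen_add_left[abs_def] scalar_add alt_add algebra_simps)

text \<open>A derivation over \<open>K\<close> treats the elements \<open>scaleA c 1\<close> as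
  constants, so the derivative term picks up no extra summand.\<close>

lemma brk_mono_const_left:
  "brk_mono (scaleA c 1 * a) xs b ys = scalar (scaleA c 1) * brk_mono a xs b ys"
proof -
  have "brk_gen (scaleA c 1 * a) xs = (\<lambda>y. scalar (scaleA c 1) * brk_gen a xs y)"
    by (simp add: fun_eq_iff brk_gen_def rho_const_mult scalar_mult right_diff_distrib mult.assoc)
  then show ?thesis
    by (simp add: brk_mono_def alt_scalar_mult scalar_mult right_diff_distrib mult.assoc
        scalar_moves neg_one_power_moves)
qed

lemma brk_mono_const_right:
  "brk_mono a xs (scaleA c 1 * b) ys = scalar (scaleA c 1) * brk_mono a xs b ys"
  unfolding brk_mono_def rho_const_mult alt_scalar_mult_scalar
  by (simp add: scalar_mult right_diff_distrib mult.assoc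
      scalar_moves neg_one_power_moves)

text \<open>Two sources of signs must agree. The product rule for \<open>rho\<close> leaves
  \<open>[a X, c]\<close>, of degree p - 1, to be moved past \<open>gens ys\<close>; the contraction
  by \<open>brk_gen a xs\<close>, with values of degree p, brings its own sign from
  \<open>alt_append\<close>.\<close>

lemma brk_mono_append:
  "brk_mono a xs (b * c) (ys @ zs) \<approx>
    brk_mono a xs b ys * (scalar c * gens zs) +
    (- 1) ^ (Suc (length xs) * length ys) * (scalar b * gens ys * brk_mono a xs c zs)"
proof -
  let ?D = "\<lambda>b. alt (\<lambda>x. scalar (rho x b)) xs" and ?s = "(- 1) ^ Suc (length xs)"
    and ?t = "(- 1) ^ (Suc (length xs) * length ys)"
  have D: "?D (b * c) = scalar c * ?D b + scalar b * ?D c"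
  proof -
    have "rho x (b * c) = c * rho x b + b * rho x c" for x
      by (simp add: rho_mult mult.commute)
    then show ?thesis
      by (simp add: scalar_add alt_add alt_scalar_mult_scalar)
  qed
  have D_gens: "?D c * gens ys \<approx> ?t * (gens ys * ?D c)"
  \<comment> \<open>For empty \<open>xs\<close> the contraction is 0; otherwise its degree is p - 1,
    of the same parity as the p + 1 in the exponent.\<close>
  proof (cases xs)
    case (Cons x xs')
    have "homog (length xs') (?D c)"
      using homog_alt[of 0 "\<lambda>x. scalar (rho x c)" xs] by (simp add: homog_scalar Cons)
    from ext_cong_homog_commute[OF this homog_gens[of ys]] show ?thesis
      by (auto simp: Cons minus_one_power_iff split: if_splits)
  qed simp
  have "brk_mono a xs (b * c) (ys @ zs) =
      ?s * (scalar a * (scalar c * (?D b * (gens ys * gens zs)))) +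
      ?s * (scalar a * (scalar b * (?D c * gens ys * gens zs))) +
      scalar b * (scalar c * alt (brk_gen a xs) (ys @ zs))"
    by (simp add: brk_mono_def D algebra_simps scalar_mult)
  also have "\<dots> \<approx>
      ?s * (scalar a * (scalar c * (?D b * (gens ys * gens zs)))) +
      ?s * (scalar a * (scalar b * (?t * (gens ys * ?D c) * gens zs))) +
      scalar b * (scalar c * (alt (brk_gen a xs) ys * gens zs + ?t * (gens ys * alt (brk_gen a xs) zs)))"
    by (intro ext_cong_add ext_cong_mult_left ext_cong_mult_right ext_cong_refl
        D_gens alt_append homog_brk_gen)
  also have "\<dots> = brk_mono a xs b ys * (scalar c * gens zs) +
      ?t * (scalar b * gens ys * brk_mono a xs c zs)"
    by (simp add: brk_mono_def distrib_left distrib_right mult.assoc scalar_moves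
        scalar_left_commute[of "alt f xs" for f xs] neg_one_power_moves del: power_Suc mult_Suc)
  finally show ?thesis .
qed

text \<open>Exchanging the arguments turns the term with all the Lie brackets into itself up to
  sign, and exchanges the two terms that differentiate a coefficient.\<close>

lemma brk_mono_antisym:
  "brk_mono a xs b ys \<approx>
    - ((- 1) ^ (Suc (length xs) * Suc (length ys)) * brk_mono b ys a xs)"
proof -
  let ?D = "\<lambda>b xs. alt (\<lambda>x. scalar (rho x b)) xs"
  let ?S = "\<lambda>xs ys. alt (\<lambda>y. alt (\<lambda>x. gen (brk x y)) xs) ys"
  let ?p = "Suc (length xs)" and ?q = "Suc (length ys)"
  have expand: "brk_mono a xs b ys = (- 1) ^ Suc (length xs) * (scalar a * (?D b xs * gens ys)) +
      scalar a * (scalar b * ?S xs ys) - scalar b * (gens xs * ?D a ys)" for a xs b ys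
    by (simp add: brk_mono_def brk_gen_def[abs_def] alt_diff alt_scalar_mult alt_mult_right
        right_diff_distrib scalar_moves)
  have D_gens: "?D a ys * gens xs \<approx> (- 1) ^ (length xs * Suc (length ys)) * (gens xs * ?D a ys)"
    for a xs ys
  proof (cases ys)
    case (Cons y ys')
    have "homog (length ys') (?D a ys)"
      using homog_alt[of 0 "\<lambda>x. scalar (rho x a)" ys] by (simp add: homog_scalar Cons)
    from ext_cong_homog_commute[OF this homog_gens[of xs]] show ?thesis
      by (auto simp: Cons minus_one_power_iff mult.commute split: if_splits)
  qed simp
  have S_swap: "?S xs ys \<approx> - ((- 1) ^ (?p * ?q) * ?S ys xs)"
  proof -
    have "?S xs ys = (\<Sum>j<length ys. \<Sum>i<length xs. (- 1) ^ (i + j) *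
        (gen (brk (xs ! i) (ys ! j)) * (gens (omit i xs) * gens (omit j ys))))"
      by (simp add: alt_def sum_distrib_left sum_distrib_right mult.assoc power_add neg_one_power_moves)
    also have "\<dots> \<approx> (\<Sum>j<length ys. \<Sum>i<length xs. (- 1) ^ (i + j) *
        (- gen (brk (ys ! j) (xs ! i)) * ((- 1) ^ (?p * ?q) * (gens (omit j ys) * gens (omit i xs)))))"
    proof (rule ext_cong_sum, rule ext_cong_sum, rule ext_cong_mult_left, rule ext_cong_mult)
      fix i j assume ij: "j \<in> {..<length ys}" "i \<in> {..<length xs}"
      show "gen (brk (xs ! i) (ys ! j)) \<approx> - gen (brk (ys ! j) (xs ! i))"
        using ext_cong_gen_uminus[of "brk (ys ! j) (xs ! i)"]
        by (simp add: brk_anticommute[of "xs ! i"])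
      \<comment> \<open>The indices \<open>i\<close> and \<open>j\<close> exist, so both words are
        nonempty and subtracting 1 is not truncated.\<close>
      have "even ((length xs - 1) * (length ys - 1)) = even (?p * ?q)"
        using ij by auto
      then have "(- 1 :: ('g, 'a) free_alg) ^ ((length xs - 1) * (length ys - 1)) = (- 1) ^ (?p * ?q)"
        unfolding minus_one_power_iff by simp
      then show "gens (omit i xs) * gens (omit j ys) \<approx>
          (- 1) ^ (?p * ?q) * (gens (omit j ys) * gens (omit i xs))"
        using ij ext_cong_gens_commute[of "omit i xs" "omit j ys"] by (simp add: length_omit)
    qed
    also have "\<dots> = (\<Sum>i<length xs. \<Sum>j<length ys. (- 1) ^ (i + j) *
        (- gen (brk (ys ! j) (xs ! i)) * ((- 1) ^ (?p * ?q) * (gens (omit j ys) * gens (omit i xs)))))"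
      by (rule sum.swap)
    also have "\<dots> = - ((- 1) ^ (?p * ?q) * ?S ys xs)"
      by (simp add: alt_def sum_distrib_left sum_distrib_right mult.assoc power_add
          neg_one_power_moves sum_negf del: mult_Suc mult_Suc_right power_Suc)
    finally show ?thesis .
  qed
  have "brk_mono a xs b ys \<approx> (- 1) ^ ?p * (scalar a * ((- 1) ^ (length ys * ?p) * (gens ys * ?D b xs))) +
      scalar a * (scalar b * - ((- 1) ^ (?p * ?q) * ?S ys xs)) - scalar b * (gens xs * ?D a ys)"
    unfolding expand
    by (intro ext_cong_add ext_cong_diff ext_cong_mult_left D_gens S_swap ext_cong_refl)
  also have "\<dots> = (- 1) ^ (?p * ?q) * (scalar a * (gens ys * ?D b xs)) -
      (- 1) ^ (?p * ?q) * (scalar b * (scalar a * ?S ys xs)) - scalar b * (gens xs * ?D a ys)"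
    by (simp add: neg_one_power_moves scalar_moves power_add mult.assoc mult.commute[of "length ys"])
  also have "\<dots> \<approx> (- 1) ^ (?p * ?q) * (scalar a * (gens ys * ?D b xs)) -
      (- 1) ^ (?p * ?q) * (scalar b * (scalar a * ?S ys xs)) -
      (- 1) ^ (?p * ?q) * ((- 1) ^ ?q * (scalar b * (?D a ys * gens xs)))"
  proof (rule ext_cong_diff[OF ext_cong_refl])
    have "(- 1) ^ (?p * ?q) * ((- 1) ^ ?q * (scalar b * (?D a ys * gens xs))) \<approx>
        (- 1) ^ (?p * ?q) * ((- 1) ^ ?q * (scalar b * ((- 1) ^ (length xs * ?q) * (gens xs * ?D a ys))))"
      by (intro ext_cong_mult_left D_gens)
    also have "\<dots> = (- 1) ^ (?p * ?q + ?q + length xs * ?q) * (scalar b * (gens xs * ?D a ys))"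
      by (simp add: neg_one_power_moves power_add mult.assoc
          del: mult_Suc mult_Suc_right power_Suc add_Suc_right)
    also have "\<dots> = scalar b * (gens xs * ?D a ys)"
    proof -
      \<comment> \<open>With p and q the lengths of the words, the exponent is (q + 1)(2 p +
        2).\<close>
      have "even (?p * ?q + ?q + length xs * ?q)" by auto
      then show ?thesis by (simp only: minus_one_power_iff if_True mult_1)
    qed
    finally show "scalar b * (gens xs * ?D a ys) \<approx>
        (- 1) ^ (?p * ?q) * ((- 1) ^ ?q * (scalar b * (?D a ys * gens xs)))"
      by (rule ext_cong_sym)
  qed
  also have "\<dots> = - ((- 1) ^ (?p * ?q) * brk_mono b ys a xs)"
    unfolding expand[of b ys a xs] by (simp only: right_diff_distrib distrib_left minus_diff_eq minus_add_distrib) simp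
  finally show ?thesis .
qed

section \<open>Biadditive extension to the free algebra\<close>

definition brk_left :: "'a \<Rightarrow> 'g list \<Rightarrow> ('g, 'a) free_alg \<Rightarrow> ('g, 'a) free_alg" where
  "brk_left a xs v = lin (\<lambda>z b. brk_mono a xs b (letters z)) v"

definition brk_free :: "('g, 'a) free_alg \<Rightarrow> ('g, 'a) free_alg \<Rightarrow> ('g, 'a) free_alg" where
  "brk_free u v = lin (\<lambda>w a. brk_left a (letters w) v) u"

lemma brk_left_single: "brk_left a xs (Poly_Mapping.single z b) = brk_mono a xs b (letters z)"
  by (simp add: brk_left_def lin_single)

lemma brk_left_zero [simp]: "brk_left a xs 0 = 0" "brk_left 0 xs v = 0"
  by (simp_all add: brk_left_def lin_def)

lemma brk_left_add: "brk_left a xs (u + v) = brk_left a xs u + brk_left a xs v"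
  unfolding brk_left_def by (rule lin_add) (simp_all add: brk_mono_add_right)

lemma brk_left_uminus: "brk_left a xs (- u) = - brk_left a xs u"
  using brk_left_add[of a xs u "- u"] by (simp add: eq_neg_iff_add_eq_0 add.commute)

lemma brk_left_diff: "brk_left a xs (u - v) = brk_left a xs u - brk_left a xs v"
  using brk_left_add[of a xs u "- v"] by (simp add: brk_left_uminus)

lemma brk_left_add_left: "brk_left (a + b) xs v = brk_left a xs v + brk_left b xs v"
  by (simp add: brk_left_def brk_mono_add_left lin_distrib)

lemma brk_free_single: "brk_free (Poly_Mapping.single w a) v = brk_left a (letters w) v"
  by (simp add: brk_free_def lin_single)

lemma brk_free_zero [simp]: "brk_free 0 v = 0" "brk_free u 0 = 0"
  by (simp_all add: brk_free_def lin_def)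

lemma brk_free_add_left: "brk_free (u + v) w = brk_free u w + brk_free v w"
  unfolding brk_free_def by (rule lin_add) (simp_all add: brk_left_add_left)

lemma brk_free_add_right: "brk_free u (v + w) = brk_free u v + brk_free u w"
  by (simp add: brk_free_def brk_left_add lin_distrib)

lemma brk_free_uminus_left: "brk_free (- u) v = - brk_free u v"
  using brk_free_add_left[of u "- u" v] by (simp add: eq_neg_iff_add_eq_0 add.commute)

lemma brk_free_uminus_right: "brk_free u (- v) = - brk_free u v"
  using brk_free_add_right[of u v "- v"] by (simp add: eq_neg_iff_add_eq_0 add.commute)

lemma brk_free_diff_left: "brk_free (u - v) w = brk_free u w - brk_free v w"
  using brk_free_add_left[of u "- v" w] by (simp add: brk_free_uminus_left)

lemma brk_free_diff_right: "brk_free u (v - w) = brk_free u v - brk_free u w"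
  using brk_free_add_right[of u v "- w"] by (simp add: brk_free_uminus_right)

text \<open>Monomials multiply by concatenating words and multiplying coefficients, so
  \<open>brk_mono_append\<close> is the case of two monomials. The sign depends on the degree of the
  left factor only; the right one is arbitrary.\<close>

lemma brk_left_mult:
  assumes "homog q u"
  shows "brk_left a xs (u * v) \<approx>
    brk_left a xs u * v + (- 1) ^ (Suc (length xs) * q) * (u * brk_left a xs v)"
proof -
  have single: "brk_left a xs (Poly_Mapping.single (Word ys) b * v) \<approx>
      brk_left a xs (Poly_Mapping.single (Word ys) b) * v +
      (- 1) ^ (Suc (length xs) * length ys) * (Poly_Mapping.single (Word ys) b * brk_left a xs v)" for ys b
  proof (induction v rule: poly_mapping_induct_single)
    case (add z c v)
    have "brk_left a xs (Poly_Mapping.single (Word ys) b * Poly_Mapping.single z c) \<approx>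
        brk_left a xs (Poly_Mapping.single (Word ys) b) * Poly_Mapping.single z c +
        (- 1) ^ (Suc (length xs) * length ys) *
          (Poly_Mapping.single (Word ys) b * brk_left a xs (Poly_Mapping.single z c))"
      using brk_mono_append[of a xs b c ys "letters z"]
      by (simp add: mult_single plus_word_def brk_left_single flip: single_eq_scalar_gens)
    from ext_cong_add[OF this add(2)] show ?case
      by (simp add: distrib_left brk_left_add algebra_simps)
  qed simp
  show ?thesis
  proof (induction u rule: poly_mapping_induct_single)
    case (add w b u)
    then have "length (letters w) = q"
      using assms by (simp add: homog_def)
    with ext_cong_add[OF single[of "letters w" b] add(2)] show ?case
      by (simp add: distrib_left distrib_right brk_left_add algebra_simps)
  qed simp
qed

section \<open>Compatibility with the relations in the second argument\<close>

lemma brk_gen_add: "brk_gen a xs (x + y) \<approx> brk_gen a xs x + brk_gen a xs y"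
proof -
  have "alt (\<lambda>z. gen (brk z (x + y))) xs \<approx> alt (\<lambda>z. gen (brk z x) + gen (brk z y)) xs"
    unfolding brk_add_right by (intro alt_cong ext_cong_gen_add)
  from ext_cong_diff[OF ext_cong_mult_left[OF this, of "scalar a"] ext_cong_refl]
  show ?thesis
    by (simp add: brk_gen_def rho_add alt_add scalar_add algebra_simps)
qed

text \<open>Here the Lie-Rinehart Leibniz rule enters: the terms \<open>rho z c\<close> it creates
  are, after moving \<open>gen x\<close> to the right, exactly \<open>[a X, c] x\<close>. The
  \<open>A\<close>-linearity of \<open>rho\<close> matches the remaining term.\<close>

lemma brk_gen_scale: "brk_gen a xs (scaleG c x) \<approx> brk_mono a xs c [x]"
proof -
  have D_gen: "alt (\<lambda>z. scalar (rho z c) * gen x) xs \<approx>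
      (- 1) ^ Suc (length xs) * (alt (\<lambda>z. scalar (rho z c)) xs * gen x)"
  proof (cases xs)
    case (Cons z zs)
    have "homog (length zs) (alt (\<lambda>z. scalar (rho z c)) xs)"
      using homog_alt[of 0 "\<lambda>z. scalar (rho z c)" xs] by (simp add: homog_scalar Cons)
    from ext_cong_homog_commute[OF homog_gen this, of x] show ?thesis
      by (simp add: alt_mult_right Cons)
  qed simp
  have "alt (\<lambda>z. gen (brk z (scaleG c x))) xs \<approx>
      alt (\<lambda>z. scalar c * gen (brk z x) + scalar (rho z c) * gen x) xs"
    unfolding leibniz
    by (intro alt_cong ext_cong_trans[OF ext_cong_gen_add] ext_cong_add ext_cong_gen_scale)
  also have "\<dots> = scalar c * alt (\<lambda>z. gen (brk z x)) xs + alt (\<lambda>z. scalar (rho z c) * gen x) xs"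
    by (simp add: alt_add alt_scalar_mult)
  also have "\<dots> \<approx> scalar c * alt (\<lambda>z. gen (brk z x)) xs +
      (- 1) ^ Suc (length xs) * (alt (\<lambda>z. scalar (rho z c)) xs * gen x)"
    by (intro ext_cong_add D_gen ext_cong_refl)
  finally have "brk_gen a xs (scaleG c x) \<approx> scalar a * (scalar c * alt (\<lambda>z. gen (brk z x)) xs +
      (- 1) ^ Suc (length xs) * (alt (\<lambda>z. scalar (rho z c)) xs * gen x)) - scalar (rho (scaleG c x) a) * gens xs"
    unfolding brk_gen_def by (intro ext_cong_diff ext_cong_mult_left ext_cong_refl)
  also have "\<dots> = brk_mono a xs c [x]"
    by (simp add: brk_mono_def brk_gen_def alt_def omit_def rho_smult scalar_mult
        distrib_left right_diff_distrib mult.assoc scalar_moves neg_one_power_moves)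
  finally show ?thesis .
qed

lemma brk_left_gen: "brk_left a xs (gen x) = brk_gen a xs x"
  by (simp add: gen_def brk_left_single brk_mono_def alt_def omit_def)

lemma brk_left_scalar_mult_gen: "brk_left a xs (scalar c * gen x) = brk_mono a xs c [x]"
  using brk_left_single[of a xs "Word [x]" c] by (simp add: single_eq_scalar_gens)

text \<open>For the square, let p be the length of \<open>xs\<close>. The value at
  \<open>gen x\<close> has degree p, so moving it past \<open>gen x\<close> gives the sign of p,
  opposite to the sign of p + 1 in the Leibniz rule, and the two terms cancel. Homogeneity is
  recorded because the Leibniz rule needs a degree for its left factor.\<close>

lemma brk_left_relation:
  assumes "r \<in> ext_relations scaleG"
  shows "brk_left a xs r \<approx> 0" and "\<exists>d. homog d r"
proof -
  from assms consider
      (add) x y where "r = gen (x + y) - gen x - gen y"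
    | (scale) c x where "r = gen (scaleG c x) - scalar c * gen x"
    | (square) x where "r = gen x * gen x"
    unfolding ext_relations_def by blast
  then have "brk_left a xs r \<approx> 0 \<and> (\<exists>d. homog d r)"
  proof cases
    case add
    have "brk_left a xs r \<approx> 0"
      using brk_gen_add[of a xs x y]
      by (simp add: add brk_left_diff brk_left_add brk_left_gen ext_cong_def diff_diff_eq)
    moreover have "homog (Suc 0) r"
      unfolding add by (intro homog_diff homog_gen)
    ultimately show ?thesis by blast
  next
    case scale
    have "brk_left a xs r \<approx> 0"
      using brk_gen_scale[of a xs c x]
      by (simp add: scale brk_left_diff brk_left_gen brk_left_scalar_mult_gen ext_cong_def)
    moreover have "homog (Suc 0) r"
      unfolding scale by (intro homog_diff homog_gen homog_scalar_mult)
    ultimately show ?thesis by blast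
  next
    case square
    have "brk_left a xs r \<approx> brk_gen a xs x * gen x +
        (- 1) ^ (Suc (length xs) * Suc 0) * (gen x * brk_gen a xs x)"
      using brk_left_mult[OF homog_gen, of a xs x "gen x"] by (simp only: square brk_left_gen)
    also have "\<dots> \<approx> (- 1) ^ (length xs * Suc 0) * (gen x * brk_gen a xs x) +
        (- 1) ^ (Suc (length xs) * Suc 0) * (gen x * brk_gen a xs x)"
      by (intro ext_cong_add ext_cong_homog_commute homog_brk_gen homog_gen ext_cong_refl)
    also have "\<dots> = 0" by simp
    finally show ?thesis
      using homog_mult[OF homog_gen[of x] homog_gen[of x]] unfolding square by blast
  qed
  then show "brk_left a xs r \<approx> 0" "\<exists>d. homog d r" by auto
qed

lemma ext_ideal_iff_cong: "u \<in> ext_ideal scaleG \<longleftrightarrow> u \<approx> 0"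
  by (simp add: ext_cong_def)

text \<open>In the Leibniz rule for \<open>r * n\<close> one term contains the value at
  \<open>r\<close> and the other contains \<open>r\<close> itself. The factor \<open>l\<close> has
  no degree of its own and is therefore split into monomials.\<close>

lemma brk_left_ideal:
  assumes "v \<in> ext_ideal scaleG"
  shows "brk_left a xs v \<approx> 0"
  using assms
proof (induction v rule: ext_ideal_induct)
  case (relation l r n)
  obtain d where d: "homog d r"
    using brk_left_relation(2)[OF relation] by blast
  have r: "r \<approx> 0"
    using relation ext_relations_subset ext_ideal_iff_cong by blast
  have rn: "r * n \<approx> 0"
    using ext_cong_mult_right[OF r, of n] by simp
  have "brk_left a xs (r * n) \<approx> brk_left a xs r * n +
      (- 1) ^ (Suc (length xs) * d) * (r * brk_left a xs n)"
    by (rule brk_left_mult[OF d])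
  also have "\<dots> \<approx> 0 * n + (- 1) ^ (Suc (length xs) * d) * (0 * brk_left a xs n)"
    by (intro ext_cong_add ext_cong_mult_left ext_cong_mult_right r brk_left_relation(1) relation)
  finally have T_rn: "brk_left a xs (r * n) \<approx> 0" by simp
  have "brk_left a xs (l * (r * n)) \<approx> 0"
  proof (induction l rule: poly_mapping_induct_single)
    case (add w b l)
    have "brk_left a xs (Poly_Mapping.single w b * (r * n)) \<approx>
        brk_left a xs (Poly_Mapping.single w b) * (r * n) +
        (- 1) ^ (Suc (length xs) * length (letters w)) *
          (Poly_Mapping.single w b * brk_left a xs (r * n))"
      by (rule brk_left_mult) (simp add: homog_single)
    also have "\<dots> \<approx> brk_left a xs (Poly_Mapping.single w b) * 0 +
        (- 1) ^ (Suc (length xs) * length (letters w)) * (Poly_Mapping.single w b * 0)"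
      by (intro ext_cong_add ext_cong_mult_left rn T_rn)
    finally have "brk_left a xs (Poly_Mapping.single w b * (r * n)) \<approx> 0"
      by simp
    from ext_cong_add[OF this add(2)] show ?case
      by (simp add: distrib_right brk_left_add)
  qed simp
  then show ?case
    by (simp add: mult.assoc)
next
  case (add u v)
  then show ?case
    using ext_cong_add[OF add] by (simp add: brk_left_add)
next
  case (uminus u)
  then show ?case
    using ext_cong_uminus[OF uminus] by (simp add: brk_left_uminus)
qed simp

section \<open>Antisymmetry and independence of representatives\<close>

lemma brk_free_ideal_right:
  assumes "v \<in> ext_ideal scaleG"
  shows "brk_free u v \<approx> 0"
proof (induction u rule: poly_mapping_induct_single)
  case (add w a u)
  then show ?case
    using ext_cong_add[OF brk_left_ideal[OF assms, of a "letters w"] add(2)]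
    by (simp add: brk_free_add_left brk_free_single)
qed simp

lemma brk_free_antisym:
  assumes "homog p u" "homog q v"
  shows "brk_free u v \<approx> - ((- 1) ^ (Suc p * Suc q) * brk_free v u)"
proof -
  have single: "brk_free u (Poly_Mapping.single z b) \<approx>
      - ((- 1) ^ (Suc p * Suc q) * brk_free (Poly_Mapping.single z b) u)"
    if "length (letters z) = q" for z b
  proof (induction u rule: poly_mapping_induct_single)
    case (add w a u)
    then have "length (letters w) = p"
      using assms(1) by (simp add: homog_def)
    with brk_mono_antisym[of a "letters w" b "letters z"] that
    have "brk_free (Poly_Mapping.single w a) (Poly_Mapping.single z b) \<approx>
      - ((- 1) ^ (Suc p * Suc q) * brk_free (Poly_Mapping.single z b) (Poly_Mapping.single w a))"
      by (simp only: brk_free_single brk_left_single)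
    from ext_cong_add[OF this add(2)] show ?case
      by (simp add: brk_free_add_left brk_free_add_right distrib_left del: mult_Suc mult_Suc_right)
  qed simp
  show ?thesis
  proof (induction v rule: poly_mapping_induct_single)
    case (add z b v)
    then have "length (letters z) = q"
      using assms(2) by (simp add: homog_def)
    from ext_cong_add[OF single[OF this, of b] add(2)] show ?case
      by (simp add: brk_free_add_left brk_free_add_right distrib_left del: mult_Suc mult_Suc_right)
  qed simp
qed

text \<open>Antisymmetry is available for homogeneous arguments only, so \<open>l\<close>,
  \<open>n\<close> and \<open>v\<close> are all split into monomials; the relation in the middle
  stays whole.\<close>

lemma brk_free_ideal_left:
  assumes "u \<in> ext_ideal scaleG"
  shows "brk_free u v \<approx> 0"
  using assms
proof (induction u rule: ext_ideal_induct)
  case (relation l r n)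
  obtain d where d: "homog d r"
    using brk_left_relation(2)[OF relation] by blast
  have single: "brk_free (Poly_Mapping.single w a * r * Poly_Mapping.single w' a') v \<approx> 0" for w w' a a'
  proof (induction v rule: poly_mapping_induct_single)
    case (add z b v)
    let ?u = "Poly_Mapping.single w a * r * Poly_Mapping.single w' a'"
    have "?u \<in> ext_ideal scaleG"
      using relation ext_relations_subset by (blast intro: ext_ideal_mult_left ext_ideal_mult_right)
    then have swapped: "brk_free (Poly_Mapping.single z b) ?u \<approx> 0"
      by (rule brk_free_ideal_right)
    let ?s = "(- 1) ^ (Suc (length (letters w) + d + length (letters w')) * Suc (length (letters z)))"
    have "brk_free ?u (Poly_Mapping.single z b) \<approx> - (?s * brk_free (Poly_Mapping.single z b) ?u)"
      by (intro brk_free_antisym homog_mult d homog_single refl)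
    also have "\<dots> \<approx> - (?s * 0)"
      by (intro ext_cong_uminus ext_cong_mult_left swapped)
    finally have "brk_free ?u (Poly_Mapping.single z b) \<approx> 0"
      by simp
    from ext_cong_add[OF this add(2)] show ?case
      by (simp add: brk_free_add_right)
  qed simp
  have "brk_free (Poly_Mapping.single w a * r * n) v \<approx> 0" for w a
  proof (induction n rule: poly_mapping_induct_single)
    case (add w' a' n)
    from ext_cong_add[OF single[of w a w' a'] add(2)] show ?case
      by (simp add: distrib_left brk_free_add_left)
  qed simp
  then show ?case
  proof (induction l rule: poly_mapping_induct_single)
    case (add w a l)
    from ext_cong_add[OF add(3) add(2)[OF add(3)]] show ?case
      by (simp add: distrib_right brk_free_add_left)
  qed simp
next
  case (add u v)
  then show ?case
    using ext_cong_add[OF add] by (simp add: brk_free_add_left)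
next
  case (uminus u)
  then show ?case
    using ext_cong_uminus[OF uminus] by (simp add: brk_free_uminus_left)
qed simp

lemma brk_free_cong:
  assumes "u \<approx> u'" "v \<approx> v'"
  shows "brk_free u v \<approx> brk_free u' v'"
proof -
  have "brk_free (u - u') v + brk_free u' (v - v') \<approx> 0 + 0"
    using assms by (intro ext_cong_add brk_free_ideal_left brk_free_ideal_right)
      (simp_all add: ext_cong_def)
  then show ?thesis
    by (simp add: ext_cong_def brk_free_diff_left brk_free_diff_right)
qed

section \<open>Existence and uniqueness on the exterior algebra\<close>

lemma brk_free_const_left:
  "brk_free (scalar (scaleA c 1) * u) v = scalar (scaleA c 1) * brk_free u v"
proof (induction u rule: poly_mapping_induct_single)
  case (add w a u)
  have "brk_left (scaleA c 1 * a) xs v = scalar (scaleA c 1) * brk_left a xs v" for xs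
    by (simp add: brk_left_def lin_def sum_distrib_left brk_mono_const_left)
  with add show ?case
    by (simp add: distrib_left brk_free_add_left scalar_def[of "scaleA c 1"] mult_single brk_free_single)
qed simp

lemma brk_free_const_right:
  "brk_free u (scalar (scaleA c 1) * v) = scalar (scaleA c 1) * brk_free u v"
proof -
  have left: "brk_left a xs (scalar (scaleA c 1) * v) = scalar (scaleA c 1) * brk_left a xs v" for a xs
  proof (induction v rule: poly_mapping_induct_single)
    case (add z b v)
    then show ?case
      by (simp add: distrib_left brk_left_add scalar_def[of "scaleA c 1"] mult_single brk_left_single
          brk_mono_const_right[unfolded scalar_def])
  qed simp
  show ?thesis
    by (simp add: brk_free_def lin_def sum_distrib_left left)
qed

text \<open>An equality before passing to the quotient: both coefficients are 1, which the anchor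
  kills, and the nested contractions already have their factors in the prescribed order.\<close>

lemma brk_free_gens:
  "brk_free (gens xs) (gens ys) =
    (\<Sum>i<length xs. \<Sum>j<length ys. (- 1) ^ (Suc i + Suc j) *
      gen (brk (xs ! i) (ys ! j)) * gens (omit i xs) * gens (omit j ys))"
proof -
  have "brk_free (gens xs) (gens ys) = alt (\<lambda>y. alt (\<lambda>x. gen (brk x y)) xs) ys"
    by (simp add: gens_eq_single brk_free_single brk_left_single brk_mono_def brk_gen_def[abs_def])
  also have "\<dots> = (\<Sum>j<length ys. \<Sum>i<length xs. (- 1) ^ (Suc i + Suc j) *
      gen (brk (xs ! i) (ys ! j)) * gens (omit i xs) * gens (omit j ys))"
    by (simp add: alt_def sum_distrib_left sum_distrib_right mult.assoc power_add neg_one_power_moves)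
  finally show ?thesis
    by (simp add: sum.swap[of _ "{..<length ys}"])
qed

lemma scalar_eq_single: "scalar a = Poly_Mapping.single (Word []) a"
  by (simp add: scalar_def zero_word_def)

lemma brk_free_gens_scalar:
  "brk_free (gens xs) (scalar a) =
    (\<Sum>i<length xs. (- 1) ^ (length xs - Suc i) * scalar (rho (xs ! i) a) * gens (omit i xs))"
proof -
  have "brk_free (gens xs) (scalar a) = (- 1) ^ Suc (length xs) * alt (\<lambda>x. scalar (rho x a)) xs"
    by (simp add: gens_eq_single[of xs] scalar_eq_single[of a] brk_free_single brk_left_single brk_mono_def)
  also have "\<dots> = (\<Sum>i<length xs. (- 1) ^ (length xs - Suc i) * scalar (rho (xs ! i) a) * gens (omit i xs))"
    unfolding alt_def sum_distrib_left
  proof (intro sum.cong refl)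
    fix i assume "i \<in> {..<length xs}"
    \<comment> \<open>The two exponents differ by 2 i + 2.\<close>
    then have "even (Suc (length xs) + i) = even (length xs - Suc i)"
      by auto
    then have "(- 1 :: ('g, 'a) free_alg) ^ (Suc (length xs) + i) = (- 1) ^ (length xs - Suc i)"
      unfolding minus_one_power_iff by simp
    then show "(- 1) ^ Suc (length xs) * ((- 1) ^ i * scalar (rho (xs ! i) a) * gens (omit i xs)) =
        (- 1) ^ (length xs - Suc i) * scalar (rho (xs ! i) a) * gens (omit i xs)"
      by (metis mult.assoc power_add)
  qed
  finally show ?thesis .
qed

lemma brk_free_scalar_gens:
  "brk_free (scalar a) (gens xs) =
    (\<Sum>i<length xs. (- 1) ^ Suc i * scalar (rho (xs ! i) a) * gens (omit i xs))"
  by (simp add: gens_eq_single[of xs] scalar_eq_single[of a] brk_free_single brk_left_single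
      brk_mono_def brk_gen_def[abs_def])
    (simp add: alt_def sum_negf flip: scalar_eq_single)

lemma brk_free_scalar_scalar: "brk_free (scalar a) (scalar b) = 0"
  by (simp add: scalar_eq_single brk_free_single brk_left_single brk_mono_def)

lemma is_schouten_bracket_exists:
  "\<exists>B. is_schouten_bracket scaleA scaleG brk rho B \<and>
    (\<forall>u v. B (ext_class scaleG u) (ext_class scaleG v) = ext_class scaleG (brk_free u v))"
proof -
  \<comment> \<open>Any representative will do, since \<open>brk_free_cong\<close> makes the
    resulting class independent of it; off the carrier the value is arbitrary.\<close>
  define rep where "rep P = (SOME u. ext_class scaleG u = P)" for P
  define B where "B P Q = ext_class scaleG (brk_free (rep P) (rep Q))" for P Q
  have rep: "rep (ext_class scaleG u) \<approx> u" for u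
    unfolding rep_def ext_class_eq_iff[symmetric] by (rule someI) (rule refl)
  have B: "B (ext_class scaleG u) (ext_class scaleG v) = ext_class scaleG (brk_free u v)" for u v
    unfolding B_def ext_class_eq_iff by (intro brk_free_cong rep)
  have "is_schouten_bracket scaleA scaleG brk rho B"
    unfolding is_schouten_bracket_def Let_def carrier_exterior_algebra
    by (auto simp: B exterior_algebra_add exterior_algebra_zero ext_scale_class brk_free_add_left
        brk_free_add_right brk_free_const_left brk_free_const_right brk_free_gens
        brk_free_gens_scalar brk_free_scalar_gens brk_free_scalar_scalar)
  with B show ?thesis by blast
qed

text \<open>A scalar factor of a nonempty word is absorbed into the first letter, so the values prescribed on
  decomposables and on scalars determine a biadditive map.\<close>

lemma ext_class_single_cases:
  obtains (scalar) b where "ext_class scaleG (Poly_Mapping.single w a) = ext_class scaleG (scalar b)"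
  | (gens) xs where "xs \<noteq> []" "ext_class scaleG (Poly_Mapping.single w a) = ext_class scaleG (gens xs)"
proof (cases w)
  case (Word ys)
  show thesis
  proof (cases ys)
    case Nil
    with Word scalar show thesis by (simp add: scalar_eq_single)
  next
    case (Cons x xs)
    have "Poly_Mapping.single w a = scalar a * gen x * gens xs"
      by (simp add: Word Cons single_eq_scalar_gens mult.assoc)
    also have "\<dots> \<approx> gens (scaleG a x # xs)"
      by (simp add: ext_cong_mult_right ext_cong_sym ext_cong_gen_scale)
    finally show thesis
      using gens[of "scaleG a x # xs"] by (simp add: ext_class_eq_iff)
  qed
qed

lemma is_schouten_bracket_unique:
  assumes B: "is_schouten_bracket scaleA scaleG brk rho B"
    and B': "is_schouten_bracket scaleA scaleG brk rho B'"
  shows "B (ext_class scaleG u) (ext_class scaleG v) = B' (ext_class scaleG u) (ext_class scaleG v)"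
proof -
  note unfold = is_schouten_bracket_def Let_def carrier_exterior_algebra ball_simps exterior_algebra_add
    exterior_algebra_zero
  have single: "B (ext_class scaleG (Poly_Mapping.single w a)) (ext_class scaleG (Poly_Mapping.single z b)) =
      B' (ext_class scaleG (Poly_Mapping.single w a)) (ext_class scaleG (Poly_Mapping.single z b))" for w a z b
    by (cases rule: ext_class_single_cases[of w a]; cases rule: ext_class_single_cases[of z b])
      (use B B' in \<open>simp_all add: unfold\<close>)
  have add': "C (ext_class scaleG (u + u')) (ext_class scaleG v) = C (ext_class scaleG u) (ext_class scaleG v)
        \<oplus>\<^bsub>exterior_algebra scaleG\<^esub> C (ext_class scaleG u') (ext_class scaleG v)"
      "C (ext_class scaleG v) (ext_class scaleG (u + u')) = C (ext_class scaleG v) (ext_class scaleG u)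
        \<oplus>\<^bsub>exterior_algebra scaleG\<^esub> C (ext_class scaleG v) (ext_class scaleG u')"
    if "is_schouten_bracket scaleA scaleG brk rho C" for C u u' v
    using that by (simp_all add: unfold)
  have "B (ext_class scaleG (Poly_Mapping.single w a)) (ext_class scaleG v) =
      B' (ext_class scaleG (Poly_Mapping.single w a)) (ext_class scaleG v)" for w a
  proof (induction v rule: poly_mapping_induct_single)
    case zero
    \<comment> \<open>The zero element is a monomial with coefficient 0, so the base case is an
      instance of the monomial case.\<close>
    show ?case using single[of w a 0 0] by simp
  next
    case (add z b v)
    then show ?case by (simp add: add'[OF B] add'[OF B'] single)
  qed
  then show ?thesis
  proof (induction u rule: poly_mapping_induct_single)
    case zero
    show ?case using zero.prems[of 0 0] by simp
  next
    case (add w a u)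
    then show ?case by (simp add: add'[OF B] add'[OF B'])
  qed
qed

text \<open>Statements about the chosen bracket become congruences about
  \<open>brk_free\<close>.\<close>

lemma schouten_bracket_class:
  "schouten_bracket scaleA scaleG brk rho (ext_class scaleG u) (ext_class scaleG v) =
    ext_class scaleG (brk_free u v)"
proof -
  obtain B where B: "is_schouten_bracket scaleA scaleG brk rho B"
    and B_class: "\<And>u v. B (ext_class scaleG u) (ext_class scaleG v) = ext_class scaleG (brk_free u v)"
    using is_schouten_bracket_exists by blast
  have "is_schouten_bracket scaleA scaleG brk rho (schouten_bracket scaleA scaleG brk rho)"
    unfolding schouten_bracket_def using B by (rule someI[of "is_schouten_bracket scaleA scaleG brk rho"])
  from is_schouten_bracket_unique[OF this B] B_class show ?thesis by simp
qed

end

theorem proposition3p6: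
  fixes scaleA :: "'k::field_char_0 \<Rightarrow> 'a::comm_ring_1 \<Rightarrow> 'a"
    and scaleG :: "'a \<Rightarrow> 'g::ab_group_add \<Rightarrow> 'g"
    and brk :: "'g \<Rightarrow> 'g \<Rightarrow> 'g"
    and rho :: "'g \<Rightarrow> 'a \<Rightarrow> 'a"
    and p q :: int
    and P Q :: "('g, 'a) free_alg set"
  assumes "lie_rinehart scaleA scaleG brk rho"
    and "P \<in> ext_power scaleG p"
    and "Q \<in> ext_power scaleG q"
  shows "schouten_bracket scaleA scaleG brk rho P Q =
         ext_scale scaleA scaleG (- ((- 1) powi ((p - 1) * (q - 1))))
           (schouten_bracket scaleA scaleG brk rho Q P)"
proof -
  interpret lie_rinehart scaleA scaleG brk rho by fact
  obtain u where P: "P = ext_class scaleG u"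
      and u: "\<forall>w\<in>Poly_Mapping.keys u. int (length (letters w)) = p"
    using assms(2) by (auto simp: ext_power_def)
  obtain v where Q: "Q = ext_class scaleG v"
      and v: "\<forall>w\<in>Poly_Mapping.keys v. int (length (letters w)) = q"
    using assms(3) by (auto simp: ext_power_def)
  have "brk_free u v \<approx> scalar (scaleA (- ((- 1) powi ((p - 1) * (q - 1)))) 1) * brk_free v u"
  \<comment> \<open>The zero element lies in every degree, negative ones included, so here
    \<open>p\<close> or \<open>q\<close> need not be a natural number; both sides vanish.\<close>
  proof (cases "u = 0 \<or> v = 0")
    case True
    then show ?thesis by auto
  next
    case False
    then obtain m n where p: "p = int m" and q: "q = int n"
      using u v by (metis keys_eq_empty ex_in_conv)
    \<comment> \<open>This passes from the integer exponent of the statement to the natural one used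
      on the free algebra: \<open>p - 1\<close> and \<open>m + 1\<close> differ by 2.\<close>
    have parity: "even ((p - 1) * (q - 1)) \<longleftrightarrow> even (Suc m * Suc n)"
      by (auto simp: p q)
    have "scalar (scaleA (- ((- 1) powi ((p - 1) * (q - 1)))) 1) =
        - ((- 1 :: ('g, 'a) free_alg) ^ (Suc m * Suc n))"
      using parity
      by (cases "even (Suc m * Suc n)")
        (simp_all add: power_int_minus_left scalar_minus del: mult_Suc mult_Suc_right)
    moreover have "brk_free u v \<approx> - ((- 1) ^ (Suc m * Suc n) * brk_free v u)"
      using u v by (intro brk_free_antisym) (simp_all add: homog_def p q)
    ultimately show ?thesis by simp
  qed
  then show ?thesis
    by (simp add: P Q schouten_bracket_class ext_scale_class ext_class_eq_iff)
qed

end
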